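(* Let $s_1 \geq 1$ and $s_2 > 1$ be real. Then $$\zeta_2(s_1,s_2) = s_1\int_1^\infty \zeta(s_1+1,u)\,\zeta(s_2,[u]+1)\,du = s_1\int_1^\infty \zeta(s_1+1,u)\,\zeta(s_2,u)\,du - A(s_1,s_2),$$ where the quantity $A(s_1,s_2)$ (defined by the second equality) satisfies $$0 \leq A(s_1,s_2) \leq s_1\int_1^\infty \frac{\zeta(s_1+1,u)}{u^{s_2}}\,du \leq \frac{s_1}{s_2-1}\,\zeta(s_1+1).$$
   Context: For real $s>1$ and real $\alpha>0$, $\zeta(s,\alpha)=\sum_{n\geq 0}(n+\alpha)^{-s}$ is the Hurwitz zeta function, and $\zeta(s)=\zeta(s,1)$ is the Riemann zeta function. For real $s_1\geq 1$ and $s_2>1$, the Euler-Zagier double zeta function is $\zeta_2(s_1,s_2)=\sum_{n_1\geq 1} n_1^{-s_1}\sum_{n_2>n_1} n_2^{-s_2}$. For real $u$, $[u]$ denotes the integral part (floor) of $u$. *)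

theory Defs
  imports "HOL-Analysis.Analysis"
begin

definition hurwitz_zeta :: "real \<Rightarrow> real \<Rightarrow> real" where
  "hurwitz_zeta s \<alpha> = (\<Sum>n. (real n + \<alpha>) powr (- s))"

definition riemann_zeta :: "real \<Rightarrow> real" where
  "riemann_zeta s = hurwitz_zeta s 1"

definition double_zeta :: "real \<Rightarrow> real \<Rightarrow> real" where
  "double_zeta s1 s2 =
     (\<Sum>\<^sub>\<infinity>n1\<in>{1::nat..}. real n1 powr (- s1) * (\<Sum>\<^sub>\<infinity>n2\<in>{n1<..}. real n2 powr (- s2)))"

(* The error term A(s1, s2), determined by
   double_zeta s1 s2 = s1 * (integral of zeta(s1 + 1, u) zeta(s2, u) over u \<ge> 1) - A(s1, s2). *)
definition double_zeta_defect :: "real \<Rightarrow> real \<Rightarrow> real" where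
  "double_zeta_defect s1 s2 =
     s1 * (LBINT u:{1..}. hurwitz_zeta (s1 + 1) u * hurwitz_zeta s2 u) - double_zeta s1 s2"

end

theory Submission
  imports Defs "HOL-Real_Asymp.Real_Asymp"
begin

text \<open>
  Since $s \int_n^{n+1} \zeta(s+1,u)\,du$ telescopes to $n^{-s}$ and $\zeta(s_2,[u]+1)$ is constant
  on $[n,n+1)$, the first integral is the double series summed piece by piece.
  The bounds on the defect come from the monotonicity of $\zeta(s_2,\cdot)$ and
  $[u] \le u$: $\zeta(s_2,[u]+1) \le \zeta(s_2,u) = u^{-s_2} + \zeta(s_2,u+1)
  \le u^{-s_2} + \zeta(s_2,[u]+1)$.
\<close>

section \<open>Convergence, monotonicity and index shift for the Hurwitz series\<close>

lemma summable_hurwitz_zeta: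
  assumes "s > 1" "u > 0"
  shows "summable (\<lambda>n. (real n + u) powr (- s))"
proof (rule summable_comparison_test_ev)
  show "summable (\<lambda>n. real n powr (- s))"
    using assms by (simp add: summable_real_powr_iff)
  show "\<forall>\<^sub>F n in sequentially. norm ((real n + u) powr (- s)) \<le> real n powr (- s)"
    \<comment> \<open>The comparison fails at \<open>n = 0\<close>, where
      \<open>0 powr (- s)\<close> is \<open>0\<close> by convention, so it is only claimed
      eventually.\<close>
    using eventually_gt_at_top[of 0]
    by eventually_elim (use assms in \<open>auto intro!: powr_mono2'\<close>)
qed

lemma hurwitz_zeta_nonneg: "s > 1 \<Longrightarrow> u > 0 \<Longrightarrow> hurwitz_zeta s u \<ge> 0"
  unfolding hurwitz_zeta_def by (intro suminf_nonneg summable_hurwitz_zeta) auto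

lemma hurwitz_zeta_antimono:
  assumes "s > 1" "0 < u" "u \<le> v"
  shows "hurwitz_zeta s v \<le> hurwitz_zeta s u"
  unfolding hurwitz_zeta_def
  using assms by (intro suminf_le summable_hurwitz_zeta) (auto intro!: powr_mono2')

lemma hurwitz_zeta_split_head:
  assumes "s > 1" "u > 0"
  shows "hurwitz_zeta s u = u powr (- s) + hurwitz_zeta s (u + 1)"
  using suminf_split_head[OF summable_hurwitz_zeta[OF assms]]
  by (simp add: hurwitz_zeta_def add_ac)

lemma borel_measurable_hurwitz_zeta [measurable]: "hurwitz_zeta s \<in> borel_measurable borel"
  unfolding hurwitz_zeta_def[abs_def] by measurable

text \<open>This turns the inner sum of \<open>double_zeta\<close> into a Hurwitz value. The terms
  are nonnegative, so the convergent series is also an unordered sum, which the bijection from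
  \<open>k\<close> to \<open>k + Suc n\<close> moves to the indices above \<open>n\<close>.\<close>

lemma hurwitz_zeta_Suc_has_sum:
  assumes "s > 1"
  shows "((\<lambda>m. real m powr (- s)) has_sum hurwitz_zeta s (real n + 1)) {n<..}"
proof -
  have "(\<lambda>k. (real k + (real n + 1)) powr (- s)) sums hurwitz_zeta s (real n + 1)"
    unfolding hurwitz_zeta_def using assms by (intro summable_sums summable_hurwitz_zeta) auto
  then have "((\<lambda>k. (real k + (real n + 1)) powr (- s)) has_sum hurwitz_zeta s (real n + 1)) UNIV"
    by (intro norm_summable_imp_has_sum) (auto simp: sums_iff)
  also have "(\<lambda>k. (real k + (real n + 1)) powr (- s)) = (\<lambda>k. real (k + Suc n) powr (- s))"
    by (simp add: add_ac)
  finally show ?thesis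
    by (rule has_sum_reindex_bij_betw[THEN iffD1, rotated])
       (rule bij_betwI[of _ _ _ "\<lambda>m. m - Suc n"], auto)
qed

section \<open>Integrals over unit intervals\<close>

lemma nn_integral_powr_unit_interval:
  fixes a s :: real
  assumes "s > 0" "a > 0"
  shows "(\<integral>\<^sup>+x\<in>{a..<a+1}. ennreal (x powr (- (s + 1))) \<partial>lborel)
           = ennreal ((a powr (- s) - (a + 1) powr (- s)) / s)"
proof -
  \<comment> \<open>Half-open intervals are wanted later for tiling, while the fundamental theorem
    is applied on the closed one; the extra endpoint is a null set.\<close>
  have "(\<integral>\<^sup>+x\<in>{a..<a+1}. ennreal (x powr (- (s + 1))) \<partial>lborel)
      = (\<integral>\<^sup>+x. ennreal (x powr (- (s + 1))) * indicator {a..a+1} x \<partial>lborel)"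
    by (intro nn_integral_cong_AE eventually_mono[OF AE_lborel_singleton[of "a + 1"]])
       (auto simp: indicator_def)
  also have "\<dots> = ennreal (- ((a + 1) powr (- s) / s) - - (a powr (- s) / s))"
  proof (rule nn_integral_FTC_Icc)
    show "((\<lambda>x. - (x powr (- s) / s)) has_real_derivative x powr (- (s + 1))) (at x)"
      if "x \<in> {a..a+1}" for x
      using that assms
      by (auto intro!: derivative_eq_intros simp: field_simps powr_diff powr_minus)
  qed (use assms in auto)
  finally show ?thesis
    by (simp add: diff_divide_distrib)
qed

text \<open>Integrating the series term by term gives telescoping differences. With nonnegative
  integrals the exchange of sum and integral requires no dominating function, and finiteness of the
  result is part of the conclusion.\<close>

lemma nn_integral_hurwitz_zeta_unit_interval:
  fixes a s :: real
  assumes "s > 0" "a > 0"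
  shows "(\<integral>\<^sup>+u\<in>{a..<a+1}. ennreal (hurwitz_zeta (s + 1) u) \<partial>lborel)
           = ennreal (a powr (- s) / s)"
proof -
  \<comment> \<open>\<open>g n\<close> is the integral of \<open>x powr (- (s + 1))\<close> over all
    x \<ge> \<open>real n + a\<close>, so \<open>g n - g (Suc n)\<close> is its part over one unit
    interval.\<close>
  define g where "g = (\<lambda>n. (real n + a) powr (- s) / s)"
  have "g \<longlonglongrightarrow> 0"
    unfolding g_def using assms by real_asymp
  then have sums: "(\<lambda>n. g n - g (Suc n)) sums (g 0 - 0)"
    by (rule telescope_sums')
  have nonneg: "g n - g (Suc n) \<ge> 0" for n
    using assms by (auto simp: g_def intro!: divide_right_mono powr_mono2')
  have piece: "(\<integral>\<^sup>+u\<in>{a..<a+1}. ennreal ((real n + u) powr (- (s + 1))) \<partial>lborel)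
                 = ennreal (g n - g (Suc n))" for n
  proof -
    have "ennreal (g n - g (Suc n)) =
        (\<integral>\<^sup>+x\<in>{real n + a..<real n + a + 1}. ennreal (x powr (- (s + 1))) \<partial>lborel)"
      using assms
      by (subst nn_integral_powr_unit_interval) (auto simp: g_def add_ac diff_divide_distrib)
    also have "\<dots> = (\<integral>\<^sup>+u. ennreal ((real n + 1 * u) powr (- (s + 1)))
                     * indicator {real n + a..<real n + a + 1} (real n + 1 * u) \<partial>lborel)"
      by (subst nn_integral_real_affine[where c = 1 and t = "real n"]) auto
    finally show ?thesis
      by (simp add: indicator_def)
  qed
  have "(\<integral>\<^sup>+u\<in>{a..<a+1}. ennreal (hurwitz_zeta (s + 1) u) \<partial>lborel)
      = (\<integral>\<^sup>+u. (\<Sum>n. ennreal ((real n + u) powr (- (s + 1))) * indicator {a..<a+1} u) \<partial>lborel)"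
  proof (intro nn_integral_cong)
    fix u :: real
    show "ennreal (hurwitz_zeta (s + 1) u) * indicator {a..<a+1} u
        = (\<Sum>n. ennreal ((real n + u) powr (- (s + 1))) * indicator {a..<a+1} u)"
      using assms summable_hurwitz_zeta[of "s + 1" u]
      by (auto simp: indicator_def hurwitz_zeta_def intro!: suminf_ennreal2[symmetric])
  qed
  also have "\<dots> = (\<Sum>n. \<integral>\<^sup>+u\<in>{a..<a+1}. ennreal ((real n + u) powr (- (s + 1))) \<partial>lborel)"
    by (rule nn_integral_suminf) measurable
  also have "\<dots> = (\<Sum>n. ennreal (g n - g (Suc n)))"
    by (simp only: piece)
  also have "\<dots> = ennreal (a powr (- s) / s)"
    using suminf_ennreal_eq[OF nonneg sums] by (simp add: g_def)
  finally show ?thesis .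
qed

text \<open>A decreasing function at the right end of a unit interval is at most its mean over that
  interval. The mean is known exactly from the previous lemma, applied with \<open>s - 1\<close> in
  place of \<open>s\<close>.\<close>

lemma hurwitz_zeta_Suc_le:
  assumes "s > 1" "a > 0"
  shows "hurwitz_zeta s (a + 1) \<le> a powr (1 - s) / (s - 1)"
proof -
  have "ennreal (hurwitz_zeta s (a + 1))
      = (\<integral>\<^sup>+u\<in>{a..<a+1}. ennreal (hurwitz_zeta s (a + 1)) \<partial>lborel)"
    by (simp add: nn_integral_cmult_indicator)
  also have "\<dots> \<le> (\<integral>\<^sup>+u\<in>{a..<a+1}. ennreal (hurwitz_zeta (s - 1 + 1) u) \<partial>lborel)"
    using assms
    by (intro nn_integral_mono) (auto simp: indicator_def intro!: hurwitz_zeta_antimono ennreal_leI)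
  also have "\<dots> = ennreal (a powr (- (s - 1)) / (s - 1))"
    using assms by (intro nn_integral_hurwitz_zeta_unit_interval) auto
  finally show ?thesis
    using assms by (subst (asm) ennreal_le_iff) auto
qed

section \<open>The double series and its integral representation\<close>

lemma summable_double_zeta:
  assumes "s1 \<ge> 1" "s2 > 1"
  shows "summable (\<lambda>n. real (Suc n) powr (- s1) * hurwitz_zeta s2 (real (Suc n) + 1))"
proof (rule summable_comparison_test')
  \<comment> \<open>The tail bound leaves terms of order \<open>1 - s1 - s2\<close>. This exponent
    is below -1 because \<open>s1\<close> \<ge> 1 and \<open>s2\<close> > 1.\<close>
  have "summable (\<lambda>n. real n powr (1 - s1 - s2))"
    using assms by (simp add: summable_real_powr_iff)
  then show "summable (\<lambda>n. real (Suc n) powr (1 - s1 - s2) / (s2 - 1))"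
    using summable_Suc_iff[of "\<lambda>n. real n powr (1 - s1 - s2)"] by (intro summable_divide) blast
  show "norm (real (Suc n) powr (- s1) * hurwitz_zeta s2 (real (Suc n) + 1))
          \<le> real (Suc n) powr (1 - s1 - s2) / (s2 - 1)" for n
  proof -
    have "norm (real (Suc n) powr (- s1) * hurwitz_zeta s2 (real (Suc n) + 1))
        = real (Suc n) powr (- s1) * hurwitz_zeta s2 (real (Suc n) + 1)"
      using assms by (simp add: hurwitz_zeta_nonneg abs_mult)
    also have "\<dots> \<le> real (Suc n) powr (- s1) * (real (Suc n) powr (1 - s2) / (s2 - 1))"
      using assms by (intro mult_left_mono hurwitz_zeta_Suc_le) auto
    also have "\<dots> = real (Suc n) powr (- s1 + (1 - s2)) / (s2 - 1)"
      by (subst powr_add) simp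
    finally show ?thesis
      by (simp add: algebra_simps)
  qed
qed

lemma double_zeta_sums:
  assumes "s1 \<ge> 1" "s2 > 1"
  shows "(\<lambda>n. real (Suc n) powr (- s1) * hurwitz_zeta s2 (real (Suc n) + 1))
           sums double_zeta s1 s2"
proof -
  let ?f = "\<lambda>n. real n powr (- s1) * hurwitz_zeta s2 (real n + 1)"
  have "double_zeta s1 s2 = infsum ?f {1..}"
    unfolding double_zeta_def using infsumI[OF hurwitz_zeta_Suc_has_sum[OF assms(2)]] by simp
  \<comment> \<open>Nonnegativity makes the series absolutely convergent, so it agrees with the
    unordered sum; the shift by one then matches the index set starting at 1.\<close>
  moreover have "((\<lambda>n. ?f (Suc n)) has_sum (\<Sum>n. ?f (Suc n))) UNIV"
    using summable_double_zeta[OF assms] assms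
    by (intro norm_summable_imp_has_sum summable_sums) (auto simp: hurwitz_zeta_nonneg abs_mult)
  then have "(?f has_sum (\<Sum>n. ?f (Suc n))) {1..}"
    by (rule has_sum_reindex_bij_betw[THEN iffD1, rotated])
       (rule bij_betwI[of _ _ _ "\<lambda>m. m - 1"], auto)
  then have "infsum ?f {1..} = (\<Sum>n. ?f (Suc n))"
    by (rule infsumI)
  ultimately show ?thesis
    using summable_sums[OF summable_double_zeta[OF assms]] by simp
qed

text \<open>On each piece between consecutive integers the second factor is constant and can be
  pulled out. The unit-interval integral of the first factor brings the denominator
  \<open>s1\<close>, which the factor \<open>s1\<close> in the theorem cancels.\<close>

lemma nn_integral_hurwitz_zeta_floor:
  assumes "s1 \<ge> 1" "s2 > 1"
  shows "(\<integral>\<^sup>+u\<in>{1..}. ennreal (hurwitz_zeta (s1 + 1) u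
             * hurwitz_zeta s2 (real_of_int \<lfloor>u\<rfloor> + 1)) \<partial>lborel)
           = ennreal (double_zeta s1 s2 / s1)"
proof -
  let ?f = "\<lambda>u. hurwitz_zeta (s1 + 1) u * hurwitz_zeta s2 (real_of_int \<lfloor>u\<rfloor> + 1)"
  define B where "B = (\<lambda>n. {real (Suc n)..<real (Suc n) + 1})"
  have floor_B: "\<lfloor>u\<rfloor> = int (Suc n)" if "u \<in> B n" for u n
    using that by (auto simp: B_def floor_eq_iff)
  have union: "(\<Union>n. B n) = {1..}"
  proof (intro equalityI subsetI)
    fix u :: real assume "u \<in> {1..}"
    \<comment> \<open>The pieces start at 1, hence the shift of the index; the subtraction on
      naturals loses nothing since the floor is at least 1.\<close>
    then have "u \<in> B (nat \<lfloor>u\<rfloor> - 1)"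
      unfolding B_def by simp
    then show "u \<in> (\<Union>n. B n)"
      by blast
  qed (auto simp: B_def)
  \<comment> \<open>The floor of a point determines the index of its piece.\<close>
  have "disjoint_family B"
    by (auto simp: disjoint_family_on_def dest!: floor_B)
  have piece: "(\<integral>\<^sup>+u\<in>B n. ennreal (?f u) \<partial>lborel)
      = ennreal (real (Suc n) powr (- s1) * hurwitz_zeta s2 (real (Suc n) + 1) / s1)" for n
  proof -
    let ?c = "hurwitz_zeta s2 (real (Suc n) + 1)"
    have c: "?c \<ge> 0"
      using assms by (intro hurwitz_zeta_nonneg) auto
    have "(\<integral>\<^sup>+u\<in>B n. ennreal (?f u) \<partial>lborel)
        = (\<integral>\<^sup>+u. ennreal ?c * (ennreal (hurwitz_zeta (s1 + 1) u) * indicator (B n) u) \<partial>lborel)"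
      using c by (intro nn_integral_cong)
        (auto simp: indicator_def floor_B mult.commute ennreal_mult'')
    also have "\<dots> = ennreal ?c * (\<integral>\<^sup>+u\<in>B n. ennreal (hurwitz_zeta (s1 + 1) u) \<partial>lborel)"
      unfolding B_def by (rule nn_integral_cmult) measurable
    also have "\<dots> = ennreal ?c * ennreal (real (Suc n) powr (- s1) / s1)"
      using assms unfolding B_def by (subst nn_integral_hurwitz_zeta_unit_interval) auto
    also have "\<dots> = ennreal (real (Suc n) powr (- s1) * ?c / s1)"
      using assms c by (subst ennreal_mult[symmetric]) (auto simp: mult.commute)
    finally show ?thesis .
  qed
  have "(\<integral>\<^sup>+u\<in>{1..}. ennreal (?f u) \<partial>lborel) = (\<Sum>n. \<integral>\<^sup>+u\<in>B n. ennreal (?f u) \<partial>lborel)"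
    unfolding union[symmetric] using \<open>disjoint_family B\<close>
    by (intro nn_integral_disjoint_family) (auto simp: B_def)
  also have "\<dots> = ennreal (double_zeta s1 s2 / s1)"
    unfolding piece using assms
    by (intro suminf_ennreal_eq sums_divide double_zeta_sums)
       (auto intro!: divide_nonneg_nonneg mult_nonneg_nonneg hurwitz_zeta_nonneg)
  finally show ?thesis .
qed

section \<open>The power majorant and the bounds for the defect\<close>

lemma has_bochner_integral_powr_atLeast_1:
  fixes s :: real
  assumes "s > 1"
  shows "has_bochner_integral lborel (\<lambda>x. indicator {1..} x *\<^sub>R x powr (- s)) (1 / (s - 1))"
proof (rule has_bochner_integral_nn_integral)
  have "(\<integral>\<^sup>+x. ennreal (x powr (- s)) * indicator {1..} x \<partial>lborel)
      = ennreal (0 - - (1 powr (1 - s) / (s - 1)))"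
  proof (rule nn_integral_FTC_atLeast[where F = "\<lambda>x. - (x powr (1 - s) / (s - 1))"])
    show "((\<lambda>x. - (x powr (1 - s) / (s - 1))) has_real_derivative x powr (- s)) (at x)"
      if "1 \<le> x" for x
    proof -
      have "((\<lambda>x. - (x powr (1 - s) / (s - 1))) has_real_derivative
              - ((1 - s) * x powr (1 - s - 1) / (s - 1))) (at x)"
        using that by (intro DERIV_minus DERIV_cdivide has_real_derivative_powr) auto
      moreover have "- ((1 - s) * x powr (1 - s - 1) / (s - 1)) = x powr (- s)"
        using assms by (simp add: field_split_simps)
      ultimately show ?thesis
        by simp
    qed
    show "((\<lambda>x. - (x powr (1 - s) / (s - 1))) \<longlongrightarrow> 0) at_top"
      using assms by real_asymp
  qed auto
  moreover have "(\<integral>\<^sup>+x. ennreal (indicator {1..} x *\<^sub>R x powr (- s)) \<partial>lborel)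
      = (\<integral>\<^sup>+x. ennreal (x powr (- s)) * indicator {1..} x \<partial>lborel)"
    by (intro nn_integral_cong) (auto simp: indicator_def)
  ultimately show "(\<integral>\<^sup>+x. ennreal (indicator {1..} x *\<^sub>R x powr (- s)) \<partial>lborel) = ennreal (1 / (s - 1))"
    by simp
qed (use assms in \<open>auto simp: indicator_def\<close>)

theorem theorem1:
  fixes s1 s2 :: real
  assumes "s1 \<ge> 1" and "s2 > 1"
  shows "set_integrable lborel {1..}
           (\<lambda>u. hurwitz_zeta (s1 + 1) u * hurwitz_zeta s2 (real_of_int \<lfloor>u\<rfloor> + 1)) \<and>
    set_integrable lborel {1..} (\<lambda>u. hurwitz_zeta (s1 + 1) u * hurwitz_zeta s2 u) \<and>
    set_integrable lborel {1..} (\<lambda>u. hurwitz_zeta (s1 + 1) u / u powr s2) \<and>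
    double_zeta s1 s2 =
           s1 * (LBINT u:{1..}. hurwitz_zeta (s1 + 1) u * hurwitz_zeta s2 (real_of_int \<lfloor>u\<rfloor> + 1)) \<and>
    s1 * (LBINT u:{1..}. hurwitz_zeta (s1 + 1) u * hurwitz_zeta s2 (real_of_int \<lfloor>u\<rfloor> + 1)) =
           s1 * (LBINT u:{1..}. hurwitz_zeta (s1 + 1) u * hurwitz_zeta s2 u)
             - double_zeta_defect s1 s2 \<and>
    0 \<le> double_zeta_defect s1 s2 \<and>
    double_zeta_defect s1 s2 \<le> s1 * (LBINT u:{1..}. hurwitz_zeta (s1 + 1) u / u powr s2) \<and>
    s1 * (LBINT u:{1..}. hurwitz_zeta (s1 + 1) u / u powr s2)
           \<le> s1 / (s2 - 1) * riemann_zeta (s1 + 1)"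
proof -
  let ?F = "\<lambda>u. hurwitz_zeta (s1 + 1) u * hurwitz_zeta s2 (real_of_int \<lfloor>u\<rfloor> + 1)"
  let ?G = "\<lambda>u. hurwitz_zeta (s1 + 1) u * hurwitz_zeta s2 u"
  let ?H = "\<lambda>u. hurwitz_zeta (s1 + 1) u / u powr s2"
  \<comment> \<open>An integrable majorant of \<open>?H\<close>: for u \<ge> 1 the first factor is
    at most its value at 1. Its integral produces the final constant.\<close>
  let ?P = "\<lambda>u. riemann_zeta (s1 + 1) * u powr (- s2)"
  have z1: "hurwitz_zeta (s1 + 1) u \<ge> 0" "hurwitz_zeta (s1 + 1) u \<le> riemann_zeta (s1 + 1)"
    if "u \<ge> 1" for u
    unfolding riemann_zeta_def
    using that assms by (auto intro!: hurwitz_zeta_nonneg hurwitz_zeta_antimono)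
  have F_nonneg: "0 \<le> ?F u" if "u \<ge> 1" for u
  proof -
    have "0 < real_of_int \<lfloor>u\<rfloor> + 1"
      using that by linarith
    then show ?thesis
      using that assms by (intro mult_nonneg_nonneg hurwitz_zeta_nonneg) auto
  qed
  have FG: "?F u \<le> ?G u" and GFH: "?G u \<le> ?F u + ?H u" if "u \<ge> 1" for u
  proof -
    have u: "0 < u" "u \<le> real_of_int \<lfloor>u\<rfloor> + 1" "0 < real_of_int \<lfloor>u\<rfloor> + 1" "real_of_int \<lfloor>u\<rfloor> + 1 \<le> u + 1"
      using that by linarith+
    show "?F u \<le> ?G u"
      using u z1[OF that] assms by (intro mult_left_mono hurwitz_zeta_antimono) auto
    have "hurwitz_zeta s2 u \<le> u powr (- s2) + hurwitz_zeta s2 (real_of_int \<lfloor>u\<rfloor> + 1)"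
      using u assms hurwitz_zeta_antimono[of s2 "real_of_int \<lfloor>u\<rfloor> + 1" "u + 1"]
        hurwitz_zeta_split_head[of s2 u] by simp
    from mult_left_mono[OF this z1(1)[OF that]] show "?G u \<le> ?F u + ?H u"
      by (simp add: powr_minus_divide algebra_simps)
  qed
  have HP: "0 \<le> ?H u" "?H u \<le> ?P u" if "u \<ge> 1" for u
    using z1[OF that] by (auto simp: powr_minus_divide intro!: divide_right_mono)

  \<comment> \<open>\<open>ennreal\<close> sends negative reals to 0, so the sign must be known
    before the nonnegative integral of \<open>?F\<close> can be read as a real one.\<close>
  have dz_nonneg: "double_zeta s1 s2 \<ge> 0"
  proof (rule sums_le[OF _ sums_zero double_zeta_sums[OF assms]])
    show "0 \<le> real (Suc n) powr (- s1) * hurwitz_zeta s2 (real (Suc n) + 1)" for n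
      using assms by (intro mult_nonneg_nonneg hurwitz_zeta_nonneg) auto
  qed
  \<comment> \<open>The finite nonnegative integral yields integrability and the value of the real
    integral together.\<close>
  have "has_bochner_integral lborel (\<lambda>u. indicator {1..} u *\<^sub>R ?F u) (double_zeta s1 s2 / s1)"
  proof (rule has_bochner_integral_nn_integral)
    have "(\<integral>\<^sup>+u. ennreal (indicator {1..} u *\<^sub>R ?F u) \<partial>lborel)
        = (\<integral>\<^sup>+u\<in>{1..}. ennreal (?F u) \<partial>lborel)"
      by (intro nn_integral_cong) (auto simp: indicator_def)
    then show "(\<integral>\<^sup>+u. ennreal (indicator {1..} u *\<^sub>R ?F u) \<partial>lborel) = ennreal (double_zeta s1 s2 / s1)"
      using nn_integral_hurwitz_zeta_floor[OF assms] by simp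
    show "AE u in lborel. 0 \<le> indicator {1..} u *\<^sub>R ?F u"
      using F_nonneg by (auto simp: indicator_def)
    show "0 \<le> double_zeta s1 s2 / s1"
      using dz_nonneg assms by simp
  qed auto
  then have F: "set_integrable lborel {1..} ?F" "(LBINT u:{1..}. ?F u) = double_zeta s1 s2 / s1"
    by (simp_all add: has_bochner_integral_iff set_integrable_def set_lebesgue_integral_def)

  have "set_integrable lborel {1..} (\<lambda>u. u powr (- s2))"
    and int_P: "(LBINT u:{1..}. u powr (- s2)) = 1 / (s2 - 1)"
    using has_bochner_integral_powr_atLeast_1[OF assms(2)]
    by (simp_all add: has_bochner_integral_iff set_integrable_def set_lebesgue_integral_def)
  then have P: "set_integrable lborel {1..} ?P"
    by (intro set_integrable_mult_right)

  have H: "set_integrable lborel {1..} ?H"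
  proof (rule set_integrable_bound[OF P])
    have "norm (?H u) \<le> norm (?P u)" if "u \<ge> 1" for u
      using HP[OF that] unfolding real_norm_def by linarith
    then show "AE u in lborel. u \<in> {1..} \<longrightarrow> norm (?H u) \<le> norm (?P u)"
      by auto
  qed (auto simp: set_borel_measurable_def)
  have FH: "set_integrable lborel {1..} (\<lambda>u. ?F u + ?H u)"
    using F(1) H by (rule set_integral_add)
  \<comment> \<open>The upper estimate for \<open>?G\<close> also serves as its integrable majorant,
    so integrability of \<open>?G\<close> follows from that of \<open>?F\<close> and
    \<open>?H\<close>.\<close>
  have G: "set_integrable lborel {1..} ?G"
  proof (rule set_integrable_bound[OF FH])
    have "norm (?G u) \<le> norm (?F u + ?H u)" if "u \<ge> 1" for u
      using F_nonneg[OF that] FG[OF that] GFH[OF that] unfolding real_norm_def by linarith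
    then show "AE u in lborel. u \<in> {1..} \<longrightarrow> norm (?G u) \<le> norm (?F u + ?H u)"
      by auto
  qed (auto simp: set_borel_measurable_def)

  have int_FG: "(LBINT u:{1..}. ?F u) \<le> (LBINT u:{1..}. ?G u)"
    using FG by (intro set_integral_mono F G) auto
  have "(LBINT u:{1..}. ?G u) \<le> (LBINT u:{1..}. ?F u + ?H u)"
    using GFH by (intro set_integral_mono FH G) auto
  then have int_GFH: "(LBINT u:{1..}. ?G u) \<le> (LBINT u:{1..}. ?F u) + (LBINT u:{1..}. ?H u)"
    using set_integral_add(2)[OF F(1) H] by simp
  have "(LBINT u:{1..}. ?H u) \<le> (LBINT u:{1..}. ?P u)"
    using HP by (intro set_integral_mono H P) auto
  then have int_HP: "(LBINT u:{1..}. ?H u) \<le> riemann_zeta (s1 + 1) / (s2 - 1)"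
    using int_P by simp

  have s1: "s1 > 0"
    using assms by simp
  have dz: "double_zeta s1 s2 = s1 * (LBINT u:{1..}. ?F u)"
    using F(2) s1 by simp
  \<comment> \<open>After rewriting with \<open>dz\<close>, the defect is \<open>s1\<close> times
    the difference of the integrals of \<open>?G\<close> and \<open>?F\<close>, so both bounds
    reduce to the integrated inequalities.\<close>
  have "0 \<le> double_zeta_defect s1 s2"
    unfolding double_zeta_defect_def dz using int_FG s1 by simp
  moreover have "double_zeta_defect s1 s2 \<le> s1 * (LBINT u:{1..}. ?H u)"
    unfolding double_zeta_defect_def dz
    using mult_left_mono[OF int_GFH, of s1] s1 by (simp add: algebra_simps)
  moreover have "s1 * (LBINT u:{1..}. ?H u) \<le> s1 / (s2 - 1) * riemann_zeta (s1 + 1)"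
    using mult_left_mono[OF int_HP, of s1] s1 by simp
  ultimately show ?thesis
    using F(1) G H dz by (simp add: double_zeta_defect_def)
qed

end
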